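(* Let $n\ge 1$ be an integer, $V=[n]=\{1,\dots,n\}$, and let $S=(s_{ij})_{i,j\in V}$ be a real matrix with $s_{ij}\ge 0$ for all $i,j\in V$. Define the facility location function $f:2^V\to\mathbb{R}_{\ge 0}$ by $$f(A)=\sum_{i\in V}\max_{a\in A}s_{ia},\qquad A\subseteq V,$$ with the convention $\max_{a\in\emptyset}s_{ia}=0$. Then $f$ is entropic.
   Context: A set function $f:2^{[n]}\to\mathbb{R}_{\ge 0}$ is called entropic if there exist jointly distributed (discrete) random variables $X_1,\dots,X_n$ such that $f(A)=H(X_A)$ for all $A\subseteq[n]$, where $X_A=(X_i)_{i\in A}$ and $H$ denotes (joint) Shannon entropy, with $H(X_\emptyset)=0$. *)

theory Defs
  imports "HOL-Probability.Information"
begin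

(* The joint variable X_A = (X_i)_{i in A}, as an extensional function on A. *)
definition joint_rv :: "(nat \<Rightarrow> 'w \<Rightarrow> 'v) \<Rightarrow> nat set \<Rightarrow> 'w \<Rightarrow> nat \<Rightarrow> 'v" where
  "joint_rv X A = (\<lambda>\<omega>. \<lambda>i\<in>A. X i \<omega>)"

(* Y takes countably many values with mass function P(Y = y), and its Shannon entropy to base b
   is the finite number h.  The finite_entropy clause (measurability of Y and convergence of the
   series of p log p) is needed because the Bochner integral behind the constant entropy is 0
   when that series diverges. *)
definition has_shannon_entropy :: "real \<Rightarrow> 'w measure \<Rightarrow> ('w \<Rightarrow> 'v) \<Rightarrow> real \<Rightarrow> bool" where
  "has_shannon_entropy b M Y h \<longleftrightarrow>
     countable (Y ` space M) \<and>
     information_space.finite_entropy M b (count_space (Y ` space M)) Y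
       (\<lambda>y. measure M {\<omega> \<in> space M. Y \<omega> = y}) \<and>
     prob_space.entropy M b (count_space (Y ` space M)) Y = h"

(* Values are encoded as natural numbers, i.e. each X_i has a countable alphabet.  The sample
   space has type nat => nat; this loses nothing, since the joint law of arbitrary variables
   X_1, ..., X_n with values in nat lives on nat => nat, with the coordinates as variables. *)
definition entropic :: "real \<Rightarrow> nat \<Rightarrow> (nat set \<Rightarrow> real) \<Rightarrow> bool" where
  "entropic b n f \<longleftrightarrow>
     (\<forall>A. A \<subseteq> {1..n} \<longrightarrow> 0 \<le> f A) \<and>
     (\<exists>(M :: (nat \<Rightarrow> nat) measure) (X :: nat \<Rightarrow> (nat \<Rightarrow> nat) \<Rightarrow> nat).
        prob_space M \<and>
        (\<forall>i\<in>{1..n}. X i \<in> measurable M (count_space UNIV)) \<and>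
        (\<forall>A. A \<subseteq> {1..n} \<longrightarrow> has_shannon_entropy b M (joint_rv X A) (f A)))"

definition facility_location :: "nat \<Rightarrow> (nat \<Rightarrow> nat \<Rightarrow> real) \<Rightarrow> nat set \<Rightarrow> real" where
  "facility_location n s A =
     (\<Sum>i\<in>{1..n}. if A = {} then 0 else Max ((\<lambda>a. s i a) ` A))"

end

theory Submission
  imports Defs "HOL-Real_Asymp.Real_Asymp"
begin

text \<open>
  Cutting each function \<open>s i\<close> at the sorted values of the matrix writes the facility location
  function as a nonnegative combination of the functions sending \<open>A\<close> to 1 if \<open>A\<close> meets \<open>B\<close>
  and to 0 otherwise (a weighted coverage function). Given weights \<open>w k\<close> and sets \<open>B k\<close>, take
  independent \<open>Z k\<close> with entropy \<open>w k\<close> and let \<open>X j\<close> collect the \<open>Z k\<close> with \<open>j \<in> B k\<close>. Then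
  the joint variable of \<open>A\<close> carries the same information as the \<open>Z k\<close> whose \<open>B k\<close> meets \<open>A\<close>, so
  by independence its entropy is the sum of the corresponding weights.
\<close>

section \<open>Finite distributions of prescribed entropy\<close>

lemma entropy_path_tendsto_0:
  fixes m :: real
  assumes "0 < m"
  shows "((\<lambda>x. - ((1 - m * x) * ln (1 - m * x)) - m * (x * ln x)) \<longlongrightarrow> 0) (at_right 0)"
  using assms by real_asymp

text \<open>All masses are required to be strictly positive so that, later, the logarithm of a
  product of them splits into a sum.\<close>

lemma exists_distribution_with_entropy:
  fixes b w :: real
  assumes "1 < b" "0 \<le> w"
  shows "\<exists>(m::nat) q. (\<forall>z<m. 0 < q z) \<and> (\<Sum>z<m. q z) = 1 \<and> - (\<Sum>z<m. q z * log b (q z)) = w"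
proof (cases "w = 0")
  case True
  show ?thesis
    by (rule exI[of _ 1], rule exI[of _ "\<lambda>_. 1"]) (simp add: True)
next
  case False
  define W where "W = w * ln b"
  have W: "0 < W" using False assms by (simp add: W_def)
  \<comment> \<open>The target \<open>W\<close> is in nats. The uniform distribution on
    \<open>m + 1\<close> values has entropy \<open>ln (m + 1)\<close>, which this choice of
    \<open>m\<close> puts above \<open>W\<close>.\<close>
  obtain m :: nat where m: "exp W < real m"
    using reals_Archimedean2 by blast
  have m0: "0 < real m" using m exp_gt_zero[of W] by linarith
  text \<open>\<open>h x\<close> is the entropy, in nats, of the distribution with \<open>m\<close> values of probability \<open>x\<close> and one of
    probability \<open>1 - m x\<close>; the intermediate value theorem applies between \<open>0\<close> and the uniform
    distribution at \<open>e\<close>.\<close>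
  define h where "h = (\<lambda>x. - ((1 - real m * x) * ln (1 - real m * x)) - real m * (x * ln x))"
  define e where "e = 1 / (real m + 1)"
  have e0: "0 < e" using m0 by (simp add: e_def)
  have me: "1 - real m * e = e" using m0 by (simp add: e_def field_simps)
  have "h e = - (real m + 1) * e * ln e"
    unfolding h_def me by (simp add: algebra_simps)
  also have "\<dots> = - ln e" using m0 by (simp add: e_def field_simps)
  also have "\<dots> = ln (real m + 1)" using m0 by (simp add: e_def ln_div)
  finally have he: "h e = ln (real m + 1)" .
  have hW: "W \<le> h e"
    unfolding he using m m0 by (subst ln_ge_iff) auto
  have "eventually (\<lambda>x. h x < W) (at_right 0)"
    using order_tendstoD(2)[OF entropy_path_tendsto_0[OF m0] W] by (simp add: h_def)
  moreover have "eventually (\<lambda>x. x \<in> {0<..<e}) (at_right 0)"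
    using e0 by (rule eventually_at_right_real)
  ultimately have "eventually (\<lambda>x. h x < W \<and> x \<in> {0<..<e}) (at_right 0)"
    by (rule eventually_conj)
  \<comment> \<open>The interval starts at a positive \<open>a\<close> and not at 0, because
    \<open>ln\<close> is not continuous at 0.\<close>
  then obtain a where a: "h a < W" "0 < a" "a < e"
    using eventually_happens[of _ "at_right (0::real)"] by fastforce
  have pos: "0 < x \<and> 0 < 1 - real m * x" if "a \<le> x" "x \<le> e" for x
  proof -
    have "real m * x \<le> real m * e" using that m0 by simp
    then show ?thesis using me e0 a that by linarith
  qed
  have "continuous_on {a..e} h"
    unfolding h_def using pos by (intro continuous_intros) force+
  then obtain x where x: "a \<le> x" "x \<le> e" "h x = W"
    using IVT'[of h a W e] a hW by auto
  define q where "q = (\<lambda>z::nat. if z = 0 then 1 - real m * x else x)"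
  have "- (\<Sum>z<Suc m. q z * log b (q z)) = h x / ln b"
    using assms unfolding sum.lessThan_Suc_shift q_def h_def log_def
    by (simp add: field_simps)
  moreover have "(\<Sum>z<Suc m. q z) = 1"
    unfolding sum.lessThan_Suc_shift q_def by simp
  moreover have "\<forall>z<Suc m. 0 < q z" using pos[OF x(1,2)] by (simp add: q_def)
  moreover have "h x / ln b = w" using x assms by (simp add: W_def)
  ultimately show ?thesis by metis
qed

section \<open>Independent coordinates on finite alphabets\<close>

locale product_distribution =
  fixes K :: "nat set" and D :: "nat \<Rightarrow> nat set" and q :: "nat \<Rightarrow> nat \<Rightarrow> real"
  assumes finite_K: "finite K"
    and finite_D: "\<And>k. k \<in> K \<Longrightarrow> finite (D k)"
    and q_pos: "\<And>k z. k \<in> K \<Longrightarrow> z \<in> D k \<Longrightarrow> 0 < q k z"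
    and q_sum: "\<And>k. k \<in> K \<Longrightarrow> (\<Sum>z\<in>D k. q k z) = 1"
begin

definition joint_mass :: "(nat \<Rightarrow> nat) \<Rightarrow> real" where
  "joint_mass \<omega> = (\<Prod>k\<in>K. q k (\<omega> k))"

text \<open>On a point measure every subset of the sample space is measurable, so any function of
  the outcome is a random variable.\<close>

definition joint_measure :: "(nat \<Rightarrow> nat) measure" where
  "joint_measure = point_measure (Pi\<^sub>E K D) joint_mass"

lemma finite_outcomes: "finite (Pi\<^sub>E K D)"
  using finite_K finite_D by (rule finite_PiE)

lemma joint_mass_nonneg: "\<omega> \<in> Pi\<^sub>E K D \<Longrightarrow> 0 \<le> joint_mass \<omega>"
  unfolding joint_mass_def by (intro prod_nonneg) (auto simp: PiE_iff intro: less_imp_le[OF q_pos])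

lemma space_joint_measure: "space joint_measure = Pi\<^sub>E K D"
  by (simp add: joint_measure_def space_point_measure)

lemma measure_joint_measure:
  "S \<subseteq> Pi\<^sub>E K D \<Longrightarrow> measure joint_measure S = (\<Sum>\<omega>\<in>S. joint_mass \<omega>)"
  by (simp add: joint_measure_def measure_point_measure_finite_if[OF finite_outcomes joint_mass_nonneg])

lemma prob_space_joint_measure: "prob_space joint_measure"
proof
  have "(\<Sum>\<omega>\<in>Pi\<^sub>E K D. joint_mass \<omega>) = 1"
    unfolding joint_mass_def
    by (subst prod_sum_PiE[symmetric]) (simp_all add: finite_K finite_D q_sum)
  then show "emeasure joint_measure (space joint_measure) = 1"
    by (simp add: joint_measure_def space_point_measure emeasure_point_measure_finite finite_outcomes
        joint_mass_nonneg sum_ennreal)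
qed

text \<open>This is independence: a cylinder is again a box, with the alphabets in \<open>C\<close>
  shrunk to singletons, so its mass factorises, and each factor outside \<open>C\<close> sums to
  1.\<close>

lemma measure_cylinder:
  assumes "C \<subseteq> K" and \<omega>: "\<omega> \<in> Pi\<^sub>E K D"
  shows "measure joint_measure {\<omega>' \<in> Pi\<^sub>E K D. \<forall>k\<in>C. \<omega>' k = \<omega> k} = (\<Prod>k\<in>C. q k (\<omega> k))"
proof -
  define E where "E k = (if k \<in> C then {\<omega> k} else D k)" for k
  have "{\<omega>' \<in> Pi\<^sub>E K D. \<forall>k\<in>C. \<omega>' k = \<omega> k} = Pi\<^sub>E K E"
  proof (intro set_eqI iffI)
    fix \<omega>' assume "\<omega>' \<in> {\<omega>' \<in> Pi\<^sub>E K D. \<forall>k\<in>C. \<omega>' k = \<omega> k}"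
    then show "\<omega>' \<in> Pi\<^sub>E K E" by (auto simp: PiE_iff E_def)
  next
    fix \<omega>' assume E: "\<omega>' \<in> Pi\<^sub>E K E"
    have "\<omega>' k = \<omega> k" if "k \<in> C" for k
      using PiE_mem[OF E, of k] that assms(1) by (auto simp: E_def)
    moreover have "\<omega>' k \<in> D k" if "k \<in> K" for k
      using PiE_mem[OF E that] PiE_mem[OF \<omega> that] by (auto simp: E_def split: if_splits)
    ultimately show "\<omega>' \<in> {\<omega>' \<in> Pi\<^sub>E K D. \<forall>k\<in>C. \<omega>' k = \<omega> k}"
      using E by (simp add: PiE_iff)
  qed
  then have "measure joint_measure {\<omega>' \<in> Pi\<^sub>E K D. \<forall>k\<in>C. \<omega>' k = \<omega> k}
      = (\<Sum>\<omega>'\<in>Pi\<^sub>E K E. joint_mass \<omega>')"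
    by (metis (no_types, lifting) measure_joint_measure mem_Collect_eq subsetI)
  also have "\<dots> = (\<Prod>k\<in>K. \<Sum>z\<in>E k. q k z)"
    unfolding joint_mass_def
    by (rule prod_sum_PiE[symmetric]) (auto simp: E_def finite_K finite_D)
  also have "\<dots> = (\<Prod>k\<in>K. if k \<in> C then q k (\<omega> k) else 1)"
    by (rule prod.cong) (auto simp: E_def q_sum)
  also have "\<dots> = (\<Prod>k\<in>C. q k (\<omega> k))"
    using assms finite_K by (simp add: prod.If_cases Int_absorb1)
  finally show ?thesis .
qed

text \<open>The function \<open>g\<close> is absorbed into the factor of coordinate
  \<open>k\<close>; all other factors sum to 1.\<close>

lemma sum_joint_mass_coordinate:
  assumes "k \<in> K"
  shows "(\<Sum>\<omega>\<in>Pi\<^sub>E K D. joint_mass \<omega> * g (\<omega> k)) = (\<Sum>z\<in>D k. q k z * g z)"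
proof -
  have "(\<Sum>\<omega>\<in>Pi\<^sub>E K D. joint_mass \<omega> * g (\<omega> k))
      = (\<Sum>\<omega>\<in>Pi\<^sub>E K D. \<Prod>j\<in>K. q j (\<omega> j) * (if j = k then g (\<omega> j) else 1))"
    using assms by (intro sum.cong)
      (simp_all add: joint_mass_def prod.distrib prod.delta finite_K)
  also have "\<dots> = (\<Prod>j\<in>K. \<Sum>z\<in>D j. q j z * (if j = k then g z else 1))"
    by (rule prod_sum_PiE[symmetric]) (auto simp: finite_K finite_D)
  also have "\<dots> = (\<Prod>j\<in>K. if j = k then \<Sum>z\<in>D k. q k z * g z else 1)"
    by (rule prod.cong) (auto simp: q_sum)
  also have "\<dots> = (\<Sum>z\<in>D k. q k z * g z)"
    using assms by (simp add: finite_K)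
  finally show ?thesis .
qed

text \<open>By the hypothesis on \<open>Y\<close>, its value and the coordinates in \<open>C\<close>
  determine each other. Hence the log-probability of a value of \<open>Y\<close> is the sum of those
  of the coordinates in \<open>C\<close>, and taking expectations adds up the marginal
  entropies.\<close>

lemma has_shannon_entropy_coordinates:
  fixes Y :: "(nat \<Rightarrow> nat) \<Rightarrow> 'v"
  assumes b: "1 < b" and C: "C \<subseteq> K"
    and Y: "\<And>\<omega> \<omega>'. \<omega> \<in> Pi\<^sub>E K D \<Longrightarrow> \<omega>' \<in> Pi\<^sub>E K D \<Longrightarrow> Y \<omega>' = Y \<omega> \<longleftrightarrow> (\<forall>k\<in>C. \<omega>' k = \<omega> k)"
  shows "has_shannon_entropy b joint_measure Y (\<Sum>k\<in>C. - (\<Sum>z\<in>D k. q k z * log b (q k z)))"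
proof -
  interpret prob_space joint_measure by (rule prob_space_joint_measure)
  interpret information_space joint_measure b by unfold_locales (rule b)
  let ?\<Omega> = "Pi\<^sub>E K D"
  define p where "p y = measure joint_measure {\<omega> \<in> space joint_measure. Y \<omega> = y}" for y
  have sf: "simple_function joint_measure Y"
    using finite_outcomes by (simp add: joint_measure_def)
  have p_Y: "p (Y \<omega>) = (\<Prod>k\<in>C. q k (\<omega> k))" if "\<omega> \<in> ?\<Omega>" for \<omega>
  proof -
    have "{\<omega>' \<in> space joint_measure. Y \<omega>' = Y \<omega>} = {\<omega>' \<in> ?\<Omega>. \<forall>k\<in>C. \<omega>' k = \<omega> k}"
      using Y that by (auto simp: space_joint_measure)
    then show ?thesis unfolding p_def using measure_cylinder[OF C that] by simp
  qed
  have sd: "simple_distributed joint_measure Y p"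
    by (rule simple_distributedI[OF sf]) (auto simp: p_def vimage_def Int_def conj_commute)
  \<comment> \<open>Grouping outcomes by their value under \<open>Y\<close> turns the entropy sum
    into an expectation over the sample space.\<close>
  have "(\<Sum>y\<in>Y ` ?\<Omega>. p y * log b (p y))
      = (\<Sum>y\<in>Y ` ?\<Omega>. \<Sum>\<omega>\<in>{\<omega>\<in>?\<Omega>. Y \<omega> = y}. joint_mass \<omega> * log b (p (Y \<omega>)))"
    by (rule sum.cong) (simp_all add: p_def space_joint_measure measure_joint_measure sum_distrib_right)
  also have "\<dots> = (\<Sum>\<omega>\<in>?\<Omega>. joint_mass \<omega> * log b (p (Y \<omega>)))"
    by (rule sum.image_gen[symmetric]) (rule finite_outcomes)
  also have "\<dots> = (\<Sum>\<omega>\<in>?\<Omega>. \<Sum>k\<in>C. joint_mass \<omega> * log b (q k (\<omega> k)))"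
  proof (rule sum.cong[OF refl])
    fix \<omega> assume \<omega>: "\<omega> \<in> ?\<Omega>"
    have q0: "0 < q k (\<omega> k)" if "k \<in> C" for k
      using \<omega> that C by (intro q_pos) (auto simp: PiE_iff)
    have "ln (\<Prod>k\<in>C. q k (\<omega> k)) = (\<Sum>k\<in>C. ln (q k (\<omega> k)))"
      using q0 by (intro ln_prod) (force simp: finite_subset[OF C finite_K])+
    then have "log b (\<Prod>k\<in>C. q k (\<omega> k)) = (\<Sum>k\<in>C. log b (q k (\<omega> k)))"
      by (simp add: log_def sum_divide_distrib)
    then show "joint_mass \<omega> * log b (p (Y \<omega>)) = (\<Sum>k\<in>C. joint_mass \<omega> * log b (q k (\<omega> k)))"
      by (simp add: p_Y[OF \<omega>] sum_distrib_left)
  qed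
  also have "\<dots> = (\<Sum>k\<in>C. \<Sum>\<omega>\<in>?\<Omega>. joint_mass \<omega> * log b (q k (\<omega> k)))"
    by (rule sum.swap)
  also have "\<dots> = (\<Sum>k\<in>C. \<Sum>z\<in>D k. q k z * log b (q k z))"
    using C by (intro sum.cong refl sum_joint_mass_coordinate) auto
  finally have "entropy b (count_space (Y ` space joint_measure)) Y
      = (\<Sum>k\<in>C. - (\<Sum>z\<in>D k. q k z * log b (q k z)))"
    using entropy_simple_distributed[OF sd] by (simp add: space_joint_measure sum_negf)
  moreover have "countable (Y ` space joint_measure)"
    by (simp add: space_joint_measure finite_outcomes countable_finite)
  ultimately show ?thesis
    unfolding has_shannon_entropy_def using finite_entropy_simple_function[OF sf] by simp
qed

end

section \<open>Weighted coverage functions are entropic\<close>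

lemma joint_rv_eq_iff:
  "joint_rv X A \<omega>' = joint_rv X A \<omega> \<longleftrightarrow> (\<forall>j\<in>A. X j \<omega>' = X j \<omega>)"
  by (auto simp: joint_rv_def restrict_def fun_eq_iff)

lemma entropic_weighted_coverage:
  fixes K :: "nat set" and w :: "nat \<Rightarrow> real" and B :: "nat \<Rightarrow> nat set"
  assumes b: "1 < b" and K: "finite K" and w: "\<And>k. k \<in> K \<Longrightarrow> 0 \<le> w k"
  shows "entropic b n (\<lambda>A. \<Sum>k\<in>K. if A \<inter> B k = {} then 0 else w k)"
proof -
  have "\<forall>k\<in>K. \<exists>(m::nat) q. (\<forall>z<m. 0 < q z) \<and> (\<Sum>z<m. q z) = 1 \<and>
      - (\<Sum>z<m. q z * log b (q z)) = w k"
    using exists_distribution_with_entropy[OF b] w by blast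
  then obtain m :: "nat \<Rightarrow> nat" and q where mq: "\<And>k. k \<in> K \<Longrightarrow> (\<forall>z<m k. 0 < q k z) \<and>
      (\<Sum>z<m k. q k z) = 1 \<and> - (\<Sum>z<m k. q k z * log b (q k z)) = w k"
    by metis
  interpret product_distribution K "\<lambda>k. {..<m k}" q
    using K mq by unfold_locales auto
  \<comment> \<open>\<open>entropic\<close> asks for variables with values in \<open>nat\<close>, so
    the selected coordinates, listed by increasing \<open>k\<close>, are packed by the injective
    \<open>list_encode\<close>. The list of indices depends only on \<open>j\<close>, so equal codes
    mean equal coordinates.\<close>
  define X :: "nat \<Rightarrow> (nat \<Rightarrow> nat) \<Rightarrow> nat" where
    "X j \<omega> = list_encode (map \<omega> (sorted_list_of_set {k\<in>K. j \<in> B k}))" for j \<omega>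
  have X: "X j \<omega>' = X j \<omega> \<longleftrightarrow> (\<forall>k\<in>K. j \<in> B k \<longrightarrow> \<omega>' k = \<omega> k)" for j \<omega> \<omega>'
    using K by (auto simp: X_def list_encode_eq)
  have "has_shannon_entropy b joint_measure (joint_rv X A)
      (\<Sum>k\<in>K. if A \<inter> B k = {} then 0 else w k)" for A
  proof -
    let ?C = "{k\<in>K. A \<inter> B k \<noteq> {}}"
    have "has_shannon_entropy b joint_measure (joint_rv X A)
        (\<Sum>k\<in>?C. - (\<Sum>z\<in>{..<m k}. q k z * log b (q k z)))"
      \<comment> \<open>Two outcomes agree under all \<open>X j\<close> with
        \<open>j \<in> A\<close> exactly when they agree at every \<open>k\<close> for which some
        \<open>j \<in> A\<close> lies in \<open>B k\<close>, that is, on \<open>?C\<close>.\<close>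
      by (rule has_shannon_entropy_coordinates[OF b]) (auto simp: joint_rv_eq_iff X)
    also have "(\<Sum>k\<in>?C. - (\<Sum>z\<in>{..<m k}. q k z * log b (q k z))) = (\<Sum>k\<in>?C. w k)"
      using mq by (intro sum.cong) auto
    also have "\<dots> = (\<Sum>k\<in>K. if A \<inter> B k \<noteq> {} then w k else 0)"
      by (rule sum.inter_filter[OF K])
    also have "\<dots> = (\<Sum>k\<in>K. if A \<inter> B k = {} then 0 else w k)"
      by (rule sum.cong) auto
    finally show ?thesis .
  qed
  moreover have "X j \<in> measurable joint_measure (count_space UNIV)" for j
    by (simp add: joint_measure_def)
  ultimately show ?thesis
    unfolding entropic_def using prob_space_joint_measure w by (auto intro!: sum_nonneg)
qed

section \<open>Layer decomposition of the facility location function\<close>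

lemma sorted_list_layer_cake:
  fixes l :: "real list"
  assumes "sorted l" and j: "j < length l"
  shows "(\<Sum>k<length l - 1. if l ! j < l ! Suc k then 0 else l ! Suc k - l ! k) = l ! j - l ! 0"
proof -
  have "(\<Sum>k<length l - 1. if l ! j < l ! Suc k then 0 else l ! Suc k - l ! k)
      = (\<Sum>k<j. l ! Suc k - l ! k)"
  \<comment> \<open>Layers below position \<open>j\<close> count in full and telescope. From
    \<open>j\<close> on, a layer either lies above \<open>l ! j\<close> or, by ties in the list, has
    width 0.\<close>
  proof (rule sum.mono_neutral_cong_right)
    show "\<forall>k\<in>{..<length l - 1} - {..<j}.
        (if l ! j < l ! Suc k then 0 else l ! Suc k - l ! k) = 0"
    proof
      fix k assume "k \<in> {..<length l - 1} - {..<j}"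
      then have "l ! j \<le> l ! k" "l ! k \<le> l ! Suc k"
        using assms by (auto intro!: sorted_nth_mono)
      then show "(if l ! j < l ! Suc k then 0 else l ! Suc k - l ! k) = 0" by auto
    qed
    show "(if l ! j < l ! Suc k then 0 else l ! Suc k - l ! k) = l ! Suc k - l ! k"
      if "k \<in> {..<j}" for k
      using sorted_nth_mono[OF assms(1), of "Suc k" j] that j by auto
  qed (use j in auto)
  also have "\<dots> = l ! j - l ! 0" by (rule sum_lessThan_telescope)
  finally show ?thesis .
qed

theorem theorem2:
  fixes n :: nat and s :: "nat \<Rightarrow> nat \<Rightarrow> real" and b :: real
  assumes "1 \<le> n"
    and "\<And>i j. i \<in> {1..n} \<Longrightarrow> j \<in> {1..n} \<Longrightarrow> 0 \<le> s i j"
    and "1 < b"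
  shows "entropic b n (facility_location n s)"
proof -
  \<comment> \<open>Inserting 0 makes the lowest threshold 0, so that the layers below a value add
    up to the value itself.\<close>
  define T where "T = insert 0 ((\<lambda>(i, j). s i j) ` ({1..n} \<times> {1..n}))"
  define l where "l = sorted_list_of_set T"
  have T: "finite T" "\<And>t. t \<in> T \<Longrightarrow> 0 \<le> t" using assms(2) by (auto simp: T_def)
  have l: "sorted l" "set l = T" using T by (simp_all add: l_def)
  have "l \<noteq> []" using l by (auto simp: T_def)
  have l_0: "l ! 0 = 0"
  proof -
    obtain j where j: "j < length l" "l ! j = 0"
      using l by (metis T_def in_set_conv_nth insertI1)
    then have "l ! 0 \<le> 0" using sorted_nth_mono[OF l(1), of 0 j] by simp
    moreover have "0 \<le> l ! 0" using T l \<open>l \<noteq> []\<close> by (metis length_greater_0_conv nth_mem)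
    ultimately show ?thesis by simp
  qed
  have layer_cake: "(\<Sum>k<length l - 1. if t < l ! Suc k then 0 else l ! Suc k - l ! k) = t"
    if "t \<in> T" for t
  proof -
    obtain j where "j < length l" "l ! j = t" using \<open>t \<in> T\<close> l(2) by (metis in_set_conv_nth)
    then show ?thesis using sorted_list_layer_cake[OF l(1), of j] l_0 by simp
  qed
  \<comment> \<open>One index per row \<open>i\<close> and layer \<open>k\<close>, coded as a
    natural number: the weight is the width of the layer, and the set consists of the columns whose
    entry in row \<open>i\<close> reaches the top of the layer.\<close>
  define I where "I = {1..n} \<times> {..<length l - 1}"
  define w where "w k = (case prod_decode k of (i, k) \<Rightarrow> l ! Suc k - l ! k)" for k
  define B where "B k = (case prod_decode k of (i, k) \<Rightarrow> {a. l ! Suc k \<le> s i a})" for k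
  define f where "f A = (\<Sum>k\<in>prod_encode ` I. if A \<inter> B k = {} then 0 else w k)" for A
  have "entropic b n f"
    unfolding f_def
  proof (rule entropic_weighted_coverage[OF assms(3)])
    show "0 \<le> w k" if "k \<in> prod_encode ` I" for k
      using that l(1) by (auto simp: w_def I_def intro!: sorted_nth_mono)
  qed (simp add: I_def)
  moreover have "f A = facility_location n s A" if A: "A \<subseteq> {1..n}" for A
  proof -
    have "f A = (\<Sum>(i, k)\<in>I. if A \<inter> {a. l ! Suc k \<le> s i a} = {} then 0 else l ! Suc k - l ! k)"
      unfolding f_def
      by (subst sum.reindex) (auto simp: inj_prod_encode w_def B_def intro!: sum.cong)
    also have "\<dots> = (\<Sum>i\<in>{1..n}. \<Sum>k<length l - 1.
        if A \<inter> {a. l ! Suc k \<le> s i a} = {} then 0 else l ! Suc k - l ! k)"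
      unfolding I_def by (rule sum.cartesian_product[symmetric])
    also have "\<dots> = facility_location n s A"
      unfolding facility_location_def
    proof (rule sum.cong[OF refl])
      fix i assume i: "i \<in> {1..n}"
      show "(\<Sum>k<length l - 1. if A \<inter> {a. l ! Suc k \<le> s i a} = {} then 0 else l ! Suc k - l ! k)
          = (if A = {} then 0 else Max ((\<lambda>a. s i a) ` A))"
      proof (cases "A = {}")
        case False
        have fin: "finite A" using A finite_subset by blast
        have "Max (s i ` A) \<in> s i ` A" using fin False by simp
        then obtain a where "a \<in> A" "Max (s i ` A) = s i a" by blast
        then have "Max (s i ` A) \<in> T" using A i by (auto simp: T_def intro!: image_eqI[of _ _ "(i, a)"])
        \<comment> \<open>A row meets the layer set exactly when its maximum over \<open>A\<close>
          reaches the threshold, so the row sum is the layer sum of that maximum, which lies in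
          \<open>T\<close> as a matrix entry.\<close>
        moreover have "A \<inter> {a. t \<le> s i a} = {} \<longleftrightarrow> Max (s i ` A) < t" for t
          using fin False by (auto simp: not_le)
        ultimately show ?thesis using layer_cake[of "Max (s i ` A)"] False by simp
      qed simp
    qed
    finally show ?thesis .
  qed
  \<comment> \<open>\<open>entropic\<close> looks only at subsets of \<open>{1..n}\<close>, so
    agreement there is enough.\<close>
  ultimately show ?thesis
    unfolding entropic_def by simp
qed

end
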